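(* Let $g(z)=z+\sum_{n\ge 2}g_nz^n\in\mathbb{A}$, write $[n]_g=g_n$, let $\phi(z)=1+B_1z+B_2z^2+\cdots$ be as in the context, and let $\mu\in\mathbb{R}$. If $f(z)=z+\sum_{n\ge2}a_nz^n\in\mathbb{A}$ belongs to $\mathcal{S}^{\ast}_g(\phi)$, then $$|a_3-\mu a_2^2|\le \frac{B_1}{[3]_g-1}\begin{cases}-2\kappa+1,&\mu\le\kappa_1,\\ 1,&\kappa_1\le\mu\le\kappa_2,\\ 2\kappa-1,&\mu\ge\kappa_2,\end{cases}$$ where $$\kappa=\frac12\left(1-\frac{B_2}{B_1}-\frac{B_1}{[2]_g-1}\left(1-\frac{[3]_g-1}{[2]_g-1}\mu\right)\right),$$ $$\kappa_1=\frac{B_1^2([2]_g-1)+(B_2-B_1)([2]_g-1)^2}{B_1^2([3]_g-1)},\qquad \kappa_2=\frac{B_1^2([2]_g-1)+(B_2+B_1)([2]_g-1)^2}{B_1^2([3]_g-1)}.$$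
   Context: $\mathbb{U}=\{z\in\mathbb{C}:|z|<1\}$, and $\mathbb{A}$ is the set of analytic functions $f$ on $\mathbb{U}$ with $f(0)=0$, $f'(0)=1$, i.e. $f(z)=z+\sum_{n\ge2}a_nz^n$. For analytic $F,\phi$ on $\mathbb{U}$, $F\prec\phi$ (subordination) means there is an analytic $u$ on $\mathbb{U}$ with $u(0)=0$, $|u(z)|<1$ and $F(z)=\phi(u(z))$ for all $z\in\mathbb{U}$. For $g(z)=z+\sum_{n\ge2}g_nz^n\in\mathbb{A}$, the $g$-derivative of $f\in\mathbb{A}$ is $D_gf(z)=\frac1z\left(z+\sum_{n\ge2}[n]_ga_nz^n\right)$, where $[n]_g=g_n$ (so $zD_gf$ is the convolution, i.e. Hadamard product, of $f$ and $g$). The function $\phi$ is analytic on $\mathbb{U}$ with positive real part, $\phi(0)=1$, $\phi'(0)>0$, $\phi(\mathbb{U})$ symmetric with respect to the real axis, with expansion $\phi(z)=1+B_1z+B_2z^2+B_3z^3+\cdots$, $B_1>0$. The class $\mathcal{S}^{\ast}_g(\phi)$ consists of all $f\in\mathbb{A}$ such that $\frac{zD_gf(z)}{f(z)}\prec\phi(z)$.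
   Formalization: Assumes additionally that [2]_g, [3]_g and B_2 are real, [2]_g ≠ 1 and [3]_g > 1; otherwise κ, κ_1, κ_2 or their order are undefined, and for [3]_g < 1 the claim fails for f(z)=z. *)

theory Defs
  imports "HOL-Complex_Analysis.Complex_Analysis"
begin

abbreviation unit_disc :: "complex set" ("\<U>")
  where "\<U> \<equiv> ball 0 1"

definition normalized_class :: "(complex \<Rightarrow> complex) set" ("\<A>")
  where "\<A> = {f. f holomorphic_on \<U> \<and> f 0 = 0 \<and> deriv f 0 = 1}"

definition taylor_coeff :: "(complex \<Rightarrow> complex) \<Rightarrow> nat \<Rightarrow> complex"
  where "taylor_coeff f n = fps_nth (fps_expansion f 0) n"

definition subordinate :: "(complex \<Rightarrow> complex) \<Rightarrow> (complex \<Rightarrow> complex) \<Rightarrow> bool" (infix "\<prec>\<^sub>s" 50)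
  where "F \<prec>\<^sub>s \<phi> \<longleftrightarrow> F holomorphic_on \<U> \<and> \<phi> holomorphic_on \<U> \<and>
    (\<exists>u. u holomorphic_on \<U> \<and> u 0 = 0 \<and> (\<forall>z\<in>\<U>. norm (u z) < 1 \<and> F z = \<phi> (u z)))"

text \<open>The $g$-derivative $\frac1z (z + \sum_{n\ge2} [n]_g a_n z^n)$,
  where $[n]_g = g_n$, with the factor $1/z$
  multiplied into the series, so that the value at the origin is also the intended one.\<close>
definition g_deriv :: "(complex \<Rightarrow> complex) \<Rightarrow> (complex \<Rightarrow> complex) \<Rightarrow> complex \<Rightarrow> complex"
  where "g_deriv g f z = 1 + (\<Sum>n. taylor_coeff g (n + 2) * taylor_coeff f (n + 2) * z ^ (n + 1))"

text \<open>Univalence of $\phi$ is not required.\<close>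
definition admissible :: "(complex \<Rightarrow> complex) \<Rightarrow> bool"
  where "admissible \<phi> \<longleftrightarrow> \<phi> holomorphic_on \<U> \<and> (\<forall>z\<in>\<U>. Re (\<phi> z) > 0) \<and> \<phi> 0 = 1 \<and>
    deriv \<phi> 0 \<in> \<real> \<and> Re (deriv \<phi> 0) > 0 \<and> cnj ` \<phi> ` \<U> = \<phi> ` \<U>"

text \<open>The quotient $z D_g f(z) / f(z)$ is of the form $0/0$ at the origin; as usual it stands for
  its continuous extension, which is what \<^const>\<open>remove_sings\<close> provides.\<close>
definition starlike_class :: "(complex \<Rightarrow> complex) \<Rightarrow> (complex \<Rightarrow> complex) \<Rightarrow> (complex \<Rightarrow> complex) set"
  where "starlike_class g \<phi> =
    {f \<in> \<A>. remove_sings (\<lambda>z. z * g_deriv g f z / f z) \<prec>\<^sub>s \<phi>}"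

end

theory Submission
  imports Defs
begin

text \<open>
  Write $zD_gf/f = \phi\circ u$ with a self-map $u(z) = c_1z + c_2z^2 + \cdots$ of the disc fixing
  the origin. Clearing the denominator and comparing the coefficients of $z^2$ and $z^3$ in
  $(\phi\circ u)\,f = z\,D_gf$ gives
  \[ ([2]_g-1)\,a_2 = B_1c_1, \qquad
     ([3]_g-1)\,a_3 = B_1c_1a_2 + B_1c_2 + B_2c_1^2, \]
  and eliminating $a_2$ and $a_3$ leaves
  \[ a_3-\mu a_2^2 = \frac{B_1}{[3]_g-1}\,(c_2 - t\,c_1^2), \qquad t = 2\kappa-1. \]
  The problem is thereby reduced to the bound $|c_2-tc_1^2|\le\max(1,|t|)$ for Schwarz functions
  (\<open>Keogh_Merkes\<close>). The parameter $t$ is affine and increasing in $\mu$, with $t=-1$ at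
  $\mu=\kappa_1$ and $t=1$ at $\mu=\kappa_2$; so the three ranges of $\mu$ are exactly those on
  which $\max(1,|t|)$ equals $-t$, $1$ and $t$.

  The bound on Schwarz functions is a convexity argument based on $|c_2|\le1-|c_1|^2$
  (\<open>Schwarz_second_coeff\<close>), which is the Schwarz--Pick inequality at the origin
  (\<open>Schwarz_Pick_at_0\<close>) for $u(z)/z$. The coefficient comparison rests on
  \<open>quotient_times_denominator\<close>, which turns the quotient with its singularity removed into
  an identity between power series.
\<close>

section \<open>Coefficient bounds for Schwarz functions\<close>

text \<open>
  If $|v|<1$ throughout, the disc automorphism that takes $v(0)$ to $0$ turns $v$ into a Schwarz
  function, with derivative $v'(0)/(1-|v(0)|^2)$ at the origin, and the Schwarz lemma applies.
  If $|v|$ attains $1$, then $v$ is constant by the maximum principle.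
\<close>
lemma Schwarz_Pick_at_0:
  assumes hol: "v holomorphic_on ball 0 1"
    and le: "\<And>z. norm z < 1 \<Longrightarrow> norm (v z) \<le> 1"
  shows "norm (deriv v 0) \<le> 1 - (norm (v 0))\<^sup>2"
proof (cases "\<exists>w. norm w < 1 \<and> norm (v w) = 1")
  case True
  then obtain w where w: "norm w < 1" "norm (v w) = 1" by blast
  have "v constant_on ball 0 1"
  proof (rule Schwarz2[OF hol])
    show "0 < 1 - norm w" using w by simp
    show "ball w (1 - norm w) \<subseteq> ball 0 1" by (simp add: ball_subset_ball_iff)
    fix z assume "norm (w - z) < 1 - norm w"
    hence "norm z < 1" using norm_triangle_ineq2[of z w] by (simp add: norm_minus_commute)
    thus "norm (v z) \<le> norm (v w)" using le w by simp
  qed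
  then obtain c where c: "\<And>z. norm z < 1 \<Longrightarrow> v z = c" by (auto simp: constant_on_def)
  have "eventually (\<lambda>z. v z = c) (nhds 0)"
    using c by (intro eventually_nhds_in_open[THEN eventually_mono, of "ball 0 1"]) auto
  hence "deriv v 0 = deriv (\<lambda>_. c) 0" by (intro deriv_cong_ev) auto
  thus ?thesis using c[of 0] c[of w] w by simp
next
  case False
  hence lt: "norm (v z) < 1" if "norm z < 1" for z using le that by force
  define a where "a = v 0"
  have a: "norm a < 1" using lt[of 0] by (simp add: a_def)
  define w where "w = Moebius_function 0 a \<circ> v"
  have holw: "w holomorphic_on ball 0 1"
    unfolding w_def using lt
    by (intro holomorphic_on_compose_gen[OF hol Moebius_function_holomorphic[OF a]]) auto
  have bound: "norm (deriv w 0) \<le> 1"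
  proof (rule Schwarz_Lemma(2)[OF holw, of 0])
    show "w 0 = 0" by (simp add: w_def a_def Moebius_function_eq_zero)
    show "norm (w z) < 1" if "norm z < 1" for z
      unfolding w_def comp_apply by (rule Moebius_function_norm_lt_1[OF a lt[OF that]])
  qed simp
  have na: "(norm a)\<^sup>2 < 1" using a by (simp add: power_less_one_iff)
  have sq: "cnj a * a = complex_of_real ((norm a)\<^sup>2)" 
    by (metis complex_norm_square mult.commute)
  have nz: "1 - cnj a * a \<noteq> 0" using na unfolding sq by (metis less_irrefl of_real_eq_1_iff right_minus_eq)
  have "(v has_field_derivative deriv v 0) (at 0)"
    using hol by (intro holomorphic_derivI[of _ "ball 0 1"]) auto
  hence "(w has_field_derivative
      (deriv v 0 * (1 - cnj a * v 0) - (v 0 - a) * (- (cnj a * deriv v 0)))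
        / ((1 - cnj a * v 0) * (1 - cnj a * v 0))) (at 0)"
    unfolding w_def o_def Moebius_function_simple using nz
    by (auto intro!: derivative_eq_intros simp: a_def)
  hence "(w has_field_derivative deriv v 0 / (1 - cnj a * a)) (at 0)"
    using nz by (simp flip: a_def)
  hence "deriv w 0 = deriv v 0 / complex_of_real (1 - (norm a)\<^sup>2)"
    by (simp add: DERIV_imp_deriv sq)
  hence "norm (deriv w 0) = norm (deriv v 0) / (1 - (norm a)\<^sup>2)"
    using na by (simp only: norm_divide norm_of_real)
  with bound na show ?thesis by (simp add: a_def divide_le_eq)
qed

text \<open>
  The function $v(z)=u(z)/z$ satisfies $|v|\le1$ by the Schwarz lemma, and its first two
  coefficients are $c_1$ and $c_2$.
\<close>
lemma Schwarz_second_coeff: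
  assumes hol: "u holomorphic_on \<U>" and u0: "u 0 = 0"
    and lt: "\<And>z. norm z < 1 \<Longrightarrow> norm (u z) < 1"
  shows "norm (taylor_coeff u 2) \<le> 1 - (norm (taylor_coeff u 1))\<^sup>2"
proof -
  obtain v where v: "v holomorphic_on \<U>" "\<And>z. norm z < 1 \<Longrightarrow> u z = z * v z" "deriv u 0 = v 0"
    using Schwarz3[OF hol u0] by blast
  have v1: "norm (v z) \<le> 1" if "norm z < 1" for z
  proof (cases "z = 0")
    case True
    thus ?thesis using Schwarz_Lemma(2)[OF hol u0 lt, of 0] v(3) by simp
  next
    case False
    have "norm z * norm (v z) \<le> norm z * 1"
      using Schwarz_Lemma(1)[OF hol u0 lt that] v(2)[OF that] by (simp add: norm_mult)
    thus ?thesis using False by (subst (asm) mult_le_cancel_left_pos) auto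
  qed
  have ev: "v has_fps_expansion fps_expansion v 0"
    using v(1) by (intro has_fps_expansion_fps_expansion[of "\<U>"]) auto
  have "(\<lambda>z. z * v z) has_fps_expansion fps_X * fps_expansion v 0"
    by (intro fps_expansion_intros ev)
  moreover have "eventually (\<lambda>z. z * v z = u z) (nhds 0)"
    using v(2) by (intro eventually_nhds_in_open[THEN eventually_mono, of "ball 0 1"]) auto
  ultimately have "u has_fps_expansion fps_X * fps_expansion v 0"
    by (simp cong: has_fps_expansion_cong)
  hence eq: "fps_expansion u 0 = fps_X * fps_expansion v 0"
    by (rule fps_expansion_eqI)
  have "taylor_coeff u 1 = v 0" "taylor_coeff u 2 = deriv v 0"
    unfolding taylor_coeff_def eq by (simp_all add: fps_expansion_def)
  thus ?thesis using Schwarz_Pick_at_0[OF v(1) v1] by simp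
qed

text \<open>
  With $x=|c_1|^2\in[0,1]$, the left-hand side is at most $(1-x)\cdot1+x\,|t|$, a convex
  combination of $1$ and $|t|$.
\<close>
lemma Keogh_Merkes:
  assumes hol: "u holomorphic_on \<U>" and u0: "u 0 = 0"
    and lt: "\<And>z. norm z < 1 \<Longrightarrow> norm (u z) < 1"
  shows "norm (taylor_coeff u 2 - t * (taylor_coeff u 1)\<^sup>2) \<le> max 1 (norm t)"
proof -
  define x where "x = (norm (taylor_coeff u 1))\<^sup>2"
  have c2: "norm (taylor_coeff u 2) \<le> 1 - x"
    unfolding x_def by (rule Schwarz_second_coeff[OF assms])
  have x: "0 \<le> x" "x \<le> 1"
    using order_trans[OF norm_ge_zero c2] by (simp_all add: x_def)
  have "norm (taylor_coeff u 2 - t * (taylor_coeff u 1)\<^sup>2)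
      \<le> norm (taylor_coeff u 2) + norm t * x"
    using norm_triangle_ineq4[of "taylor_coeff u 2" "t * (taylor_coeff u 1)\<^sup>2"]
    by (simp add: norm_mult norm_power x_def)
  also have "\<dots> \<le> (1 - x) * 1 + x * norm t" using c2 by simp
  also have "\<dots> \<le> (1 - x) * max 1 (norm t) + x * max 1 (norm t)"
    using x by (intro add_mono mult_left_mono) auto
  finally show ?thesis by (simp add: algebra_simps)
qed

section \<open>Coefficients of the subordinated quotient\<close>

lemma taylor_coeff_compose:
  assumes "\<phi> holomorphic_on \<U>" "u holomorphic_on \<U>" "u 0 = 0"
    and F: "\<And>z. norm z < 1 \<Longrightarrow> F z = \<phi> (u z)"
  shows "taylor_coeff F 0 = \<phi> 0"
    and "taylor_coeff F 1 = taylor_coeff \<phi> 1 * taylor_coeff u 1"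
    and "taylor_coeff F 2 = taylor_coeff \<phi> 1 * taylor_coeff u 2 + taylor_coeff \<phi> 2 * (taylor_coeff u 1)\<^sup>2"
proof -
  have U0: "fps_nth (fps_expansion u 0) 0 = 0"
    using assms by (simp add: fps_expansion_def)
  have "(\<phi> \<circ> u) has_fps_expansion fps_compose (fps_expansion \<phi> 0) (fps_expansion u 0)"
    using assms by (intro has_fps_expansion_compose has_fps_expansion_fps_expansion[of "\<U>"] U0) auto
  moreover have "eventually (\<lambda>z. (\<phi> \<circ> u) z = F z) (nhds 0)"
    using F by (intro eventually_nhds_in_open[THEN eventually_mono, of "ball 0 1"]) auto
  ultimately have "F has_fps_expansion fps_compose (fps_expansion \<phi> 0) (fps_expansion u 0)"
    by (simp cong: has_fps_expansion_cong)
  hence eq: "fps_expansion F 0 = fps_compose (fps_expansion \<phi> 0) (fps_expansion u 0)"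
    by (rule fps_expansion_eqI)
  show "taylor_coeff F 0 = \<phi> 0"
    unfolding taylor_coeff_def eq by (simp add: fps_expansion_def)
  show "taylor_coeff F 1 = taylor_coeff \<phi> 1 * taylor_coeff u 1"
    by (simp add: taylor_coeff_def eq fps_compose_nth)
  show "taylor_coeff F 2 = taylor_coeff \<phi> 1 * taylor_coeff u 2 + taylor_coeff \<phi> 2 * (taylor_coeff u 1)\<^sup>2"
    using U0 by (simp add: taylor_coeff_def eq fps_compose_nth fps_mult_nth power2_eq_square numeral_2_eq_2)
qed

lemma taylor_coeff_normalized:
  assumes "f \<in> \<A>"
  shows "taylor_coeff f 0 = 0" "taylor_coeff f (Suc 0) = 1"
  using assms by (auto simp: taylor_coeff_def fps_expansion_def normalized_class_def)

text \<open>
  Split $|z|^n = r^n\cdot r^n$ with $r=\sqrt{|z|}<1$: at radius $r$ the terms of one series tend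
  to $0$ and those of the other are absolutely summable.
\<close>
lemma summable_Hadamard:
  assumes f: "f holomorphic_on \<U>" and g: "g holomorphic_on \<U>" and z: "norm z < 1"
  shows "summable (\<lambda>n. taylor_coeff g n * taylor_coeff f n * z ^ n)"
proof -
  define r where "r = sqrt (norm z)"
  have r: "0 \<le> r" "r < 1" "norm z = r * r"
    using z by (auto simp: r_def real_sqrt_lt_1_iff)
  have *: "summable (\<lambda>n. norm (taylor_coeff h n * of_real r ^ n))" if "h holomorphic_on \<U>" for h
  proof -
    have "fps_conv_radius (fps_expansion h 0) \<ge> 1"
      using conv_radius_fps_expansion[of h 0 1] that by (simp add: one_ereal_def)
    moreover have "ereal (norm (of_real r :: complex)) < 1" using r by simp
    ultimately show ?thesis unfolding taylor_coeff_def
      by (intro norm_summable_fps) (rule less_le_trans)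
  qed
  show ?thesis
  proof (rule summable_comparison_test_ev[OF _ *[OF f]])
    have "(\<lambda>n. norm (taylor_coeff g n * of_real r ^ n)) \<longlonglongrightarrow> 0"
      by (rule summable_LIMSEQ_zero[OF *[OF g]])
    hence "eventually (\<lambda>n. norm (taylor_coeff g n * of_real r ^ n) < 1) sequentially"
      by (rule order_tendstoD) simp
    thus "eventually (\<lambda>n. norm (taylor_coeff g n * taylor_coeff f n * z ^ n)
       \<le> norm (taylor_coeff f n * of_real r ^ n)) sequentially"
    proof eventually_elim
      case (elim n)
      have "norm (taylor_coeff g n * taylor_coeff f n * z ^ n)
        = norm (taylor_coeff g n * of_real r ^ n) * norm (taylor_coeff f n * of_real r ^ n)"
        using r by (simp add: norm_mult norm_power power_mult_distrib)
      also have "\<dots> \<le> 1 * norm (taylor_coeff f n * of_real r ^ n)"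
        using elim by (intro mult_right_mono) auto
      finally show ?case by simp
    qed
  qed
qed

text \<open>
  The definition of the $g$-derivative starts at index 2 with one power of $z$ cancelled.
  Multiplied by $z$ it is the full Hadamard product, because normalization makes the terms of
  index 0 and 1 equal to $0$ and $z$.
\<close>
lemma times_g_deriv_has_fps_expansion:
  assumes "f \<in> \<A>" "g \<in> \<A>"
  shows "(\<lambda>z. z * g_deriv g f z) has_fps_expansion Abs_fps (\<lambda>n. taylor_coeff g n * taylor_coeff f n)"
proof (rule has_fps_expansionI)
  have "(\<lambda>n. taylor_coeff g n * taylor_coeff f n * z ^ n) sums (z * g_deriv g f z)"
    if z: "norm z < 1" for z
  proof -
    let ?h = "\<lambda>n. taylor_coeff g n * taylor_coeff f n"
    have "summable (\<lambda>n. ?h n * z ^ n)"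
      using summable_Hadamard[OF _ _ z] assms by (auto simp: normalized_class_def)
    hence *: "summable (\<lambda>n. ?h (n + 2) * z ^ (n + 2))"
      by (rule summable_ignore_initial_segment)
    have s: "summable (\<lambda>n. ?h (n + 2) * z ^ (n + 1))"
    proof (cases "z = 0")
      case False
      from summable_mult[OF *, of "inverse z"] False show ?thesis by (simp add: field_simps)
    qed simp
    from sums_mult[OF summable_sums[OF s], of z]
    have "(\<lambda>n. ?h (n + 2) * z ^ (n + 2)) sums (z * (g_deriv g f z - 1))"
      by (simp add: g_deriv_def mult_ac)
    hence "(\<lambda>n. ?h n * z ^ n) sums (z * (g_deriv g f z - 1) + (\<Sum>n<2. ?h n * z ^ n))"
      using sums_iff_shift[of "\<lambda>n. ?h n * z ^ n" 2] by simp
    moreover have "(\<Sum>n<2. ?h n * z ^ n) = z"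
      by (simp add: taylor_coeff_normalized assms numeral_2_eq_2)
    ultimately show ?thesis by (simp add: algebra_simps)
  qed
  thus "eventually (\<lambda>z. (\<lambda>n. fps_nth (Abs_fps (\<lambda>n. taylor_coeff g n * taylor_coeff f n)) n * z ^ n)
      sums (z * g_deriv g f z)) (nhds 0)"
    by (intro eventually_nhds_in_open[THEN eventually_mono, of "ball 0 1"]) auto
qed

text \<open>
  Near the origin $f$ vanishes only at the origin, so away from it the quotient with its singularity
  removed is the quotient itself and $F f = z\,D_gf$. At the origin both sides are $0$.
\<close>
lemma quotient_times_denominator:
  assumes f: "f \<in> \<A>" and g: "g \<in> \<A>"
  defines "F \<equiv> remove_sings (\<lambda>z. z * g_deriv g f z / f z)"
  assumes F: "F holomorphic_on \<U>"
  shows "fps_expansion F 0 * fps_expansion f 0 = Abs_fps (\<lambda>n. taylor_coeff g n * taylor_coeff f n)"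
proof -
  let ?h = "\<lambda>z. z * g_deriv g f z"
  have ff: "f has_fps_expansion fps_expansion f 0" and FF: "F has_fps_expansion fps_expansion F 0"
    using F f by (auto intro!: has_fps_expansion_fps_expansion[of "\<U>"] simp: normalized_class_def)
  have h: "?h has_fps_expansion Abs_fps (\<lambda>n. taylor_coeff g n * taylor_coeff f n)"
    using f g by (rule times_g_deriv_has_fps_expansion)
  have "fps_expansion f 0 \<noteq> 0"
    using taylor_coeff_normalized(2)[OF f] by (auto simp: taylor_coeff_def)
  hence nz: "eventually (\<lambda>z. f z \<noteq> 0) (at 0)"
    using has_laurent_expansion_eventually_nonzero_iff'[OF has_laurent_expansion_fps[OF ff]] by simp
  have "isolated_singularity_at (\<lambda>z. ?h z / f z) 0"
    using has_laurent_expansion_divide[OF has_laurent_expansion_fps[OF h] has_laurent_expansion_fps[OF ff]]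
    by (rule has_laurent_expansion_isolated_0)
  hence "eventually (\<lambda>z. F z = ?h z / f z) (at 0)"
    unfolding F_def by (rule eventually_remove_sings_eq_at)
  with nz have "eventually (\<lambda>z. F z * f z = ?h z) (at 0)"
    by eventually_elim auto
  moreover have "F 0 * f 0 = ?h 0" using f by (simp add: normalized_class_def)
  ultimately have "eventually (\<lambda>z. F z * f z = ?h z) (nhds 0)"
    unfolding eventually_at_filter by (auto elim: eventually_mono)
  hence "(\<lambda>z. F z * f z) has_fps_expansion Abs_fps (\<lambda>n. taylor_coeff g n * taylor_coeff f n)"
    using h by (simp cong: has_fps_expansion_cong)
  from fps_expansion_unique_complex[OF has_fps_expansion_mult[OF FF ff] this] show ?thesis .
qed

section \<open>The Fekete--Szego inequality\<close>

theorem theorem2p13: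
  fixes f g \<phi> :: "complex \<Rightarrow> complex"
    and g2 g3 B1 B2 \<mu> \<kappa> \<kappa>1 \<kappa>2 :: real
  assumes g: "g \<in> \<A>"
    and g2: "taylor_coeff g 2 = complex_of_real g2" "g2 \<noteq> 1"
    and g3: "taylor_coeff g 3 = complex_of_real g3" "g3 > 1"
    and \<phi>: "admissible \<phi>"
    and B1: "taylor_coeff \<phi> 1 = complex_of_real B1"
    and B2: "taylor_coeff \<phi> 2 = complex_of_real B2"
    and f: "f \<in> starlike_class g \<phi>"
    and \<kappa>: "\<kappa> = 1 / 2 * (1 - B2 / B1 - B1 / (g2 - 1) * (1 - (g3 - 1) / (g2 - 1) * \<mu>))"
    and \<kappa>1: "\<kappa>1 = (B1\<^sup>2 * (g2 - 1) + (B2 - B1) * (g2 - 1)\<^sup>2) / (B1\<^sup>2 * (g3 - 1))"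
    and \<kappa>2: "\<kappa>2 = (B1\<^sup>2 * (g2 - 1) + (B2 + B1) * (g2 - 1)\<^sup>2) / (B1\<^sup>2 * (g3 - 1))"
  shows "(\<mu> \<le> \<kappa>1 \<longrightarrow>
      norm (taylor_coeff f 3 - complex_of_real \<mu> * (taylor_coeff f 2)\<^sup>2)
        \<le> B1 / (g3 - 1) * (- 2 * \<kappa> + 1)) \<and>
    (\<kappa>1 \<le> \<mu> \<and> \<mu> \<le> \<kappa>2 \<longrightarrow>
      norm (taylor_coeff f 3 - complex_of_real \<mu> * (taylor_coeff f 2)\<^sup>2)
        \<le> B1 / (g3 - 1) * 1) \<and>
    (\<mu> \<ge> \<kappa>2 \<longrightarrow>
      norm (taylor_coeff f 3 - complex_of_real \<mu> * (taylor_coeff f 2)\<^sup>2)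
        \<le> B1 / (g3 - 1) * (2 * \<kappa> - 1))"
proof -
  define F where "F = remove_sings (\<lambda>z. z * g_deriv g f z / f z)"
  from f have fA: "f \<in> \<A>" and "F \<prec>\<^sub>s \<phi>"
    by (auto simp: starlike_class_def F_def)
  then obtain u where holF: "F holomorphic_on \<U>" and hol\<phi>: "\<phi> holomorphic_on \<U>"
    and u: "u holomorphic_on \<U>" "u 0 = 0" and u1: "\<And>z. norm z < 1 \<Longrightarrow> norm (u z) < 1"
    and Fu: "\<And>z. norm z < 1 \<Longrightarrow> F z = \<phi> (u z)"
    unfolding subordinate_def by auto
  define a2 a3 where "a2 = taylor_coeff f 2" and "a3 = taylor_coeff f 3"
  define c1 c2 where "c1 = taylor_coeff u 1" and "c2 = taylor_coeff u 2"
  define G H where "G = g2 - 1" and "H = g3 - 1"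
  define t where "t = 2 * \<kappa> - 1"
  have "deriv \<phi> 0 = complex_of_real B1"
    using B1 by (simp add: taylor_coeff_def fps_expansion_def)
  hence B1_pos: "B1 > 0" and \<phi>0: "\<phi> 0 = 1" using \<phi> by (simp_all add: admissible_def)
  have GH: "G \<noteq> 0" "H > 0" using g2(2) g3(2) by (simp_all add: G_def H_def)

  have p: "taylor_coeff F 0 = 1" "taylor_coeff F 1 = of_real B1 * c1"
      "taylor_coeff F 2 = of_real B1 * c2 + of_real B2 * c1\<^sup>2"
    using taylor_coeff_compose[OF hol\<phi> u Fu] by (simp_all add: \<phi>0 B1[simplified] B2 c1_def c2_def)
  have conv: "(\<Sum>i=0..n. taylor_coeff F i * taylor_coeff f (n - i)) = taylor_coeff g n * taylor_coeff f n" for n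
    using arg_cong[OF quotient_times_denominator[OF fA g holF[unfolded F_def]], of "\<lambda>P. fps_nth P n"]
    by (simp add: fps_mult_nth F_def taylor_coeff_def)
  have a2: "of_real G * a2 = of_real B1 * c1"
    using conv[of 2] p taylor_coeff_normalized[OF fA] g2(1)
    by (simp add: numeral_2_eq_2 a2_def G_def algebra_simps)
  have a3: "of_real H * a3 = of_real B1 * c1 * a2 + of_real B1 * c2 + of_real B2 * c1\<^sup>2"
    using conv[of 3] p taylor_coeff_normalized[OF fA] g3(1)
    by (simp add: numeral_2_eq_2 numeral_3_eq_3 a2_def a3_def H_def algebra_simps)

  have t: "t = - B2 / B1 - B1 / G * (1 - H / G * \<mu>)"
  proof -
    have "2 * (1 / 2 * (1 - x - y)) - 1 = - x - y" for x y :: real by (simp add: field_simps)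
    thus ?thesis by (simp only: t_def \<kappa> G_def H_def minus_divide_left)
  qed
  have FS: "a3 - of_real \<mu> * a2\<^sup>2 = of_real (B1 / H) * (c2 - of_real t * c1\<^sup>2)"
  proof -
    have a2': "a2 = of_real B1 * c1 / of_real G" using a2 GH by (simp add: field_simps)
    have a3': "a3 = (of_real B1 * c1 * a2 + of_real B1 * c2 + of_real B2 * c1\<^sup>2) / of_real H"
      using a3 GH by (simp add: field_simps)
    show ?thesis unfolding a3' a2' t using GH B1_pos
      by (simp add: field_simps power2_eq_square)
  qed
  have bound: "norm (a3 - of_real \<mu> * a2\<^sup>2) \<le> B1 / H * max 1 \<bar>t\<bar>"
  proof -
    have "norm (c2 - of_real t * c1\<^sup>2) \<le> max 1 \<bar>t\<bar>"
      using Keogh_Merkes[OF u u1, of "of_real t"] by (simp add: c1_def c2_def)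
    moreover have "0 \<le> B1 / H" using B1_pos GH by simp
    ultimately show ?thesis
      unfolding FS norm_mult norm_of_real by (simp only: abs_of_nonneg mult_left_mono)
  qed

  \<comment> \<open>The slope of $t$ as a function of $\mu$.\<close>
  define s where "s = B1 * H / G\<^sup>2"
  have s: "s > 0" using B1_pos GH by (simp add: s_def)
  have t1: "t + 1 = s * (\<mu> - \<kappa>1)" and t2: "t - 1 = s * (\<mu> - \<kappa>2)"
    unfolding t s_def \<kappa>1 \<kappa>2 G_def[symmetric] H_def[symmetric]
    using B1_pos GH by (simp_all add: field_simps power2_eq_square)
  have "\<mu> \<le> \<kappa>1 \<longleftrightarrow> t + 1 \<le> 0" "\<kappa>1 \<le> \<mu> \<longleftrightarrow> t + 1 \<ge> 0"
    "\<mu> \<le> \<kappa>2 \<longleftrightarrow> t - 1 \<le> 0" "\<kappa>2 \<le> \<mu> \<longleftrightarrow> t - 1 \<ge> 0"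
    unfolding t1 t2 using s by (simp_all add: mult_le_0_iff zero_le_mult_iff)
  hence "\<mu> \<le> \<kappa>1 \<Longrightarrow> max 1 \<bar>t\<bar> = - 2 * \<kappa> + 1"
    "\<kappa>1 \<le> \<mu> \<and> \<mu> \<le> \<kappa>2 \<Longrightarrow> max 1 \<bar>t\<bar> = 1"
    "\<kappa>2 \<le> \<mu> \<Longrightarrow> max 1 \<bar>t\<bar> = 2 * \<kappa> - 1"
    unfolding t_def by linarith+
  thus ?thesis using bound unfolding a2_def a3_def H_def by (intro conjI impI) (simp_all only:)
qed

end
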